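(* Let $f_1,\dots,f_n:\mathbb{R}^d\to\mathbb{R}$ be such that each $f_i$ is proper, closed, convex, lower bounded, and $L_i$-smooth for some $L_i>0$, and suppose that the problem of minimizing $f(x)=\sum_{i\in\mathcal{V}}f_i(x)$ over $x\in\mathbb{R}^d$ has a non-empty and bounded set of optimal solutions; let $f^\star$ be its optimal value. Let $W\in\mathbb{R}^{n\times n}$ be an averaging matrix associated with the undirected connected graph $\mathcal{G}=(\mathcal{V},\mathcal{E})$, and let $\alpha>0$. If $W$ is positive definite, then the fixed point set of DGD-ATC, $\{\mathbf{x}\in\mathbb{R}^{nd}:\mathbf{x}=\mathbf{W}(\mathbf{x}-\alpha\nabla F(\mathbf{x}))\}$, is non-empty, and every fixed point $\mathbf{x}^\star=((x_1^\star)^T,\dots,(x_n^\star)^T)^T\in\mathbb{R}^{nd}$ satisfies $$\|x_i^\star-\bar{x}^\star\|\le\frac{\alpha\sqrt{C}}{1-\beta},\quad\forall i\in\mathcal{V},$$ $$f(\bar{x}^\star)-f^\star\le\left(\frac{\alpha}{1-\beta}+\frac{L\alpha^2}{2(1-\beta)^2}\right)C,$$ where $\bar{x}^\star=\frac1n\sum_{i\in\mathcal{V}}x_i^\star$, $L=\max_{i\in\mathcal{V}}L_i$, $\beta=\max\{|\lambda_2(W)|,|\lambda_n(W)|\}$, and $$C=2L\Big(f^\star-\sum_{i\in\mathcal{V}}\inf_{x_i\in\mathbb{R}^d}f_i(x_i)\Big).$$ If, in addition, each $f_i$ is $\mu_i$-strongly convex for some $\mu_i>0$, then the fixed point is uni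que.
   Context: Network: $\mathcal{G}=(\mathcal{V},\mathcal{E})$ is an undirected, connected graph with vertex set $\mathcal{V}=\{1,\dots,n\}$, $n\ge 2$. A matrix $W=(w_{ij})\in\mathbb{R}^{n\times n}$ is an averaging matrix associated with $\mathcal{G}$ if it is entrywise non-negative, symmetric ($W=W^T$), stochastic ($W\mathbf{1}=\mathbf{1}$, with $\mathbf{1}$ the all-one vector), and satisfies $w_{ij}=0$ if and only if $\{i,j\}\notin\mathcal{E}$ and $i\neq j$. Put $\mathbf{W}=W\otimes I_d$ (Kronecker product). For a symmetric matrix $W\in\mathbb{R}^{n\times n}$, $\lambda_i(W)$ denotes its $i$th largest eigenvalue. For $\mathbf{x}=(x_1^T,\dots,x_n^T)^T\in\mathbb{R}^{nd}$ with $x_i\in\mathbb{R}^d$, $F(\mathbf{x})=\sum_{i\in\mathcal{V}}f_i(x_i)$. With $\|\cdot\|$ the $\ell_2$ norm, a differentiable $g:\mathbb{R}^d\to\mathbb{R}$ is $L$-smooth if $\|\nabla g(y)-\nabla g(x)\|\le L\|y-x\|$ for all $x,y\in\mathbb{R}^d$, and $\mu$-strongly convex if $\langle\nabla g(y)-\nabla g(x),y-x\rangle\ge\mu\|y-x\|^2$ for all $x,y\in\mathbb{R}^d$. DGD-ATC with step-size $\alpha>0$ is the iteration $\mathbf{x}^{k+1}=\mathbf{W}(\mathbf{x}^k-\alpha\nabla F(\mathbf{x}^k))$. *)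

theory Defs
  imports "HOL-Analysis.Analysis" "HOL-Computational_Algebra.Polynomial"
begin

(* Vertices are the elements of a finite type 'n, edges are unordered pairs.  Loops are tolerated:
   no notion below depends on whether {i,i} is an edge. *)

definition undirected_graph :: "'n set set \<Rightarrow> bool" where
  "undirected_graph E \<longleftrightarrow> (\<forall>e\<in>E. \<exists>i j. e = {i, j})"

definition graph_connected :: "'n set set \<Rightarrow> bool" where
  "graph_connected E \<longleftrightarrow> (\<forall>i j. (i, j) \<in> {(a, b). {a, b} \<in> E}\<^sup>*)"

definition averaging_matrix :: "'n::finite set set \<Rightarrow> real^'n^'n \<Rightarrow> bool" where
  "averaging_matrix E W \<longleftrightarrow>
     (\<forall>i j. W $ i $ j \<ge> 0) \<and> transpose W = W \<and> W *v vec 1 = vec 1 \<and>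
     (\<forall>i j. W $ i $ j = 0 \<longleftrightarrow> {i, j} \<notin> E \<and> i \<noteq> j)"

definition positive_definite :: "real^'n^'n \<Rightarrow> bool" where
  "positive_definite A \<longleftrightarrow> transpose A = A \<and> (\<forall>v. v \<noteq> 0 \<longrightarrow> v \<bullet> (A *v v) > 0)"

definition charpoly :: "'a::comm_ring_1^'n^'n \<Rightarrow> 'a poly" where
  "charpoly A = det (mat [:0, 1:] - (\<chi> i j. [:A $ i $ j:]))"

(* The i-th largest eigenvalue (i = 1, ..., n), counted with multiplicity.  Meant for symmetric
   matrices, whose characteristic polynomial splits over the reals. *)
definition nth_eigenvalue :: "nat \<Rightarrow> real^'n^'n \<Rightarrow> real" where
  "nth_eigenvalue i A = rev (sorted_list_of_multiset (proots (charpoly A))) ! (i - 1)"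

definition kronecker :: "'a::times^'n^'m \<Rightarrow> 'a^'q^'p \<Rightarrow> 'a^('n::finite \<times> 'q::finite)^('m::finite \<times> 'p::finite)" where
  "kronecker A B = (\<chi> r c. A $ fst r $ fst c * B $ snd r $ snd c)"

(* A stacked vector with n blocks of length d is indexed by (block, coordinate) pairs,
   the index type of kronecker W (mat 1). *)
definition block :: "real^('n::finite \<times> 'd::finite) \<Rightarrow> 'n \<Rightarrow> real^'d" where
  "block x i = (\<chi> k. x $ (i, k))"

definition block_mean :: "real^('n::finite \<times> 'd::finite) \<Rightarrow> real^'d" where
  "block_mean x = (1 / real CARD('n)) *\<^sub>R (\<Sum>i\<in>UNIV. block x i)"

definition grad :: "('a::real_inner \<Rightarrow> real) \<Rightarrow> 'a \<Rightarrow> 'a" where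
  "grad g x = (THE D. GDERIV g x :> D)"

definition L_smooth :: "real \<Rightarrow> ('a::real_inner \<Rightarrow> real) \<Rightarrow> bool" where
  "L_smooth L g \<longleftrightarrow> g differentiable_on UNIV \<and>
     (\<forall>x y. norm (grad g y - grad g x) \<le> L * norm (y - x))"

definition strongly_convex :: "real \<Rightarrow> ('a::real_inner \<Rightarrow> real) \<Rightarrow> bool" where
  "strongly_convex \<mu> g \<longleftrightarrow> g differentiable_on UNIV \<and>
     (\<forall>x y. (grad g y - grad g x) \<bullet> (y - x) \<ge> \<mu> * (norm (y - x))\<^sup>2)"

definition proper_function :: "('a \<Rightarrow> ereal) \<Rightarrow> bool" where
  "proper_function g \<longleftrightarrow> (\<forall>x. g x \<noteq> -\<infinity>) \<and> (\<exists>x. g x \<noteq> \<infinity>)"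

definition total_cost :: "('n \<Rightarrow> real^'d \<Rightarrow> real) \<Rightarrow> real^('n::finite \<times> 'd::finite) \<Rightarrow> real" where
  "total_cost f x = (\<Sum>i\<in>UNIV. f i (block x i))"

definition dgd_atc_step ::
  "real^'n^'n \<Rightarrow> real \<Rightarrow> ('n \<Rightarrow> real^'d \<Rightarrow> real) \<Rightarrow> real^('n::finite \<times> 'd::finite) \<Rightarrow> real^('n::finite \<times> 'd::finite)" where
  "dgd_atc_step W \<alpha> f x =
     kronecker W (mat 1 :: real^'d^'d) *v (x - \<alpha> *\<^sub>R grad (total_cost f) x)"

definition dgd_atc_fixed_points ::
  "real^'n^'n \<Rightarrow> real \<Rightarrow> ('n \<Rightarrow> real^'d \<Rightarrow> real) \<Rightarrow> (real^('n::finite \<times> 'd::finite)) set" where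
  "dgd_atc_fixed_points W \<alpha> f = {x. x = dgd_atc_step W \<alpha> f x}"

end

theory Submission
  imports Defs
begin

text \<open>
Write \<open>T = W \<otimes> I\<close>. A fixed point \<open>x = T (x - \<alpha> \<nabla>F(x))\<close> satisfies \<open>\<alpha> \<nabla>F(x) + (T\<^sup>-\<^sup>1 - I) x = 0\<close>, so the fixed
points are exactly the minimisers of \<open>F(x) + x \<bullet> (T\<^sup>-\<^sup>1 - I) x / (2\<alpha>)\<close>. This is a convex penalty method:
the quadratic form is nonnegative, and it vanishes precisely on the consensus vectors, in which all blocks
agree. The inverse is avoided by the substitution \<open>x = T y\<close>, which turns the penalty into the form
\<open>T y \<bullet> (y - T y)\<close>. It inherits its sign from \<open>T - T\<^sup>2 = (I - T) T (I - T) + T (I - T) T\<close>.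

Existence (\<open>fixed_point_exists\<close>): a convex function on a Euclidean space attains its minimum unless it stays
below its value at a given point along a whole ray. Starting at a consensus vector of minimisers of \<open>f\<close>,
such a ray would have zero penalty, hence consist of consensus vectors, and would make the set of
minimisers of \<open>f\<close> unbounded.

Estimates: comparing a fixed point \<open>x\<close> with the optimal consensus vector gives \<open>F(x) \<le> f\<^sup>\<star>\<close>
(\<open>fixed_point_le_consensus\<close>), and for smooth functions this bounds the squared norm of \<open>\<nabla>F(x)\<close> by \<open>C\<close>.
Mixing preserves the mean of the blocks, so the blocks of \<open>\<nabla>F(x)\<close> sum to zero. The deviation \<open>e\<close> of \<open>x\<close>
from its mean therefore satisfies \<open>e = T e - \<alpha> T \<nabla>F(x)\<close> inside the mean-zero subspace, where \<open>T\<close> has norm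
at most \<open>\<beta> < 1\<close>; this yields \<open>(1 - \<beta>) \<parallel>e\<parallel> \<le> \<alpha> \<surd>C\<close>. The bound on the objective at the mean follows from the
quadratic upper bound for smooth functions.

The contraction estimate (\<open>averaging_matrix_spectral_gap\<close>) has to be extracted from \<open>\<beta>\<close>, which is given by
sorted roots of the characteristic polynomial. The spectral theorem supplies an orthonormal eigenbasis
containing the normalised all-one vector, the characteristic polynomial is the product of the corresponding
linear factors, and connectedness makes the eigenvalue \<open>1\<close> simple.

Uniqueness: at two fixed points the gradients satisfy \<open>(\<nabla>F(x) - \<nabla>F(x')) \<bullet> (x - x') \<le> 0\<close>, again by the sign of
the form, which strong convexity permits only for \<open>x = x'\<close>.
\<close>

section \<open>Smooth convex functions\<close>

lemma GDERIV_unique: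
  assumes "GDERIV g x :> D" "GDERIV g x :> D'"
  shows "D = D'"
proof -
  have "(\<lambda>h. h \<bullet> D) = (\<lambda>h. h \<bullet> D')"
    using assms unfolding gderiv_def by (rule has_derivative_unique)
  then have "(D - D') \<bullet> D = (D - D') \<bullet> D'"
    by meson
  then have "(D - D') \<bullet> (D - D') = 0"
    by (simp add: inner_diff_right)
  then show ?thesis
    by simp
qed

lemma grad_eqI: "GDERIV g x :> D \<Longrightarrow> grad g x = D"
  unfolding grad_def by (blast intro: GDERIV_unique)

text \<open>In a Euclidean space the derivative, a linear functional, is represented by a vector, namely the
value of its adjoint at \<open>1\<close>; hence differentiability alone makes \<^const>\<open>grad\<close> meaningful.\<close>

lemma GDERIV_grad:
  fixes g :: "'a::euclidean_space \<Rightarrow> real"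
  assumes "g differentiable_on UNIV"
  shows "GDERIV g x :> grad g x"
proof -
  obtain g' where g': "(g has_derivative g') (at x)"
    using assms by (auto simp: differentiable_on_def differentiable_def)
  then have lin: "linear g'"
    by (rule has_derivative_linear)
  have "g' = (\<lambda>h. h \<bullet> adjoint g' 1)"
    using adjoint_works [OF lin, of _ 1] by simp
  with g' have "GDERIV g x :> adjoint g' 1"
    unfolding gderiv_def by metis
  then show ?thesis
    using grad_eqI by metis
qed

lemma GDERIV_along_line:
  assumes "GDERIV g (x + t *\<^sub>R v) :> D"
  shows "((\<lambda>s. g (x + s *\<^sub>R v)) has_real_derivative v \<bullet> D) (at t)"
proof -
  have "((\<lambda>s. g (x + s *\<^sub>R v)) has_derivative (\<lambda>h. (h *\<^sub>R v) \<bullet> D)) (at t)"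
    by (rule has_derivative_compose [of "\<lambda>s. x + s *\<^sub>R v" _ _ _ g "\<lambda>h. h \<bullet> D", OF _ assms [unfolded gderiv_def]])
       (auto intro!: derivative_eq_intros)
  then show ?thesis
    by (simp add: has_field_derivative_def mult.commute [of _ "v \<bullet> D"])
qed

text \<open>Restricting to the line through \<open>x\<close> and \<open>z\<close> reduces this to the tangent inequality for convex
functions of one real variable.\<close>

lemma convex_above_tangent:
  assumes "convex_on UNIV g" and "GDERIV g x :> D"
  shows "g x + D \<bullet> (z - x) \<le> g z"
proof -
  let ?\<phi> = "\<lambda>t. g (x + t *\<^sub>R (z - x))"
  have "convex_on UNIV ?\<phi>"
  proof (rule convex_onI)
    fix t a b :: real
    assume t: "0 < t" "t < 1"
    have "x + ((1 - t) *\<^sub>R a + t *\<^sub>R b) *\<^sub>R (z - x)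
        = (1 - t) *\<^sub>R (x + a *\<^sub>R (z - x)) + t *\<^sub>R (x + b *\<^sub>R (z - x))"
      by (simp add: algebra_simps)
    then show "?\<phi> ((1 - t) *\<^sub>R a + t *\<^sub>R b) \<le> (1 - t) * ?\<phi> a + t * ?\<phi> b"
      using convex_onD [OF assms(1), of t "x + a *\<^sub>R (z - x)" "x + b *\<^sub>R (z - x)"] t by simp
  qed simp
  moreover have "(?\<phi> has_real_derivative (z - x) \<bullet> D) (at 0)"
    by (rule GDERIV_along_line) (simp add: assms)
  ultimately have "?\<phi> 1 - ?\<phi> 0 \<ge> ((z - x) \<bullet> D) * (1 - 0)"
    by (intro convex_on_imp_above_tangent [where A = UNIV and x = 1]) auto
  then show ?thesis
    by (simp add: inner_commute)
qed

text \<open>Along the segment from \<open>x\<close> to \<open>y\<close>, the function minus its claimed quadratic upper bound has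
derivative at most \<open>0\<close>, because the gradient moves by at most \<open>L * t * norm (y - x)\<close> up to time \<open>t\<close>.\<close>

lemma L_smooth_upper_bound:
  fixes g :: "'a::euclidean_space \<Rightarrow> real"
  assumes "L_smooth L g"
  shows "g y \<le> g x + grad g x \<bullet> (y - x) + L / 2 * (norm (y - x))\<^sup>2"
proof -
  let ?v = "y - x"
  let ?\<psi> = "\<lambda>t. g (x + t *\<^sub>R ?v) - t * (grad g x \<bullet> ?v) - L / 2 * t\<^sup>2 * (norm ?v)\<^sup>2"
  have "?\<psi> 1 \<le> ?\<psi> 0"
  proof (rule DERIV_nonpos_imp_nonincreasing [where f = ?\<psi>])
    fix t :: real
    assume t: "0 \<le> t" "t \<le> 1"
    have d: "((\<lambda>s. g (x + s *\<^sub>R ?v)) has_real_derivative ?v \<bullet> grad g (x + t *\<^sub>R ?v)) (at t)"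
      using assms by (intro GDERIV_along_line GDERIV_grad) (simp add: L_smooth_def)
    have "(?\<psi> has_real_derivative
        ?v \<bullet> grad g (x + t *\<^sub>R ?v) - grad g x \<bullet> ?v - L * t * (norm ?v)\<^sup>2) (at t)"
      by (rule derivative_eq_intros d refl | simp)+
    moreover have "?v \<bullet> grad g (x + t *\<^sub>R ?v) - grad g x \<bullet> ?v \<le> L * t * (norm ?v)\<^sup>2"
    proof -
      have "?v \<bullet> grad g (x + t *\<^sub>R ?v) - grad g x \<bullet> ?v
          = (grad g (x + t *\<^sub>R ?v) - grad g x) \<bullet> ?v"
        by (metis inner_commute inner_diff_left)
      also have "\<dots> \<le> norm (grad g (x + t *\<^sub>R ?v) - grad g x) * norm ?v"
        by (rule norm_cauchy_schwarz)
      also have "\<dots> \<le> (L * norm ((x + t *\<^sub>R ?v) - x)) * norm ?v"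
        using assms unfolding L_smooth_def by (metis mult_right_mono norm_ge_zero)
      also have "\<dots> = L * t * (norm ?v)\<^sup>2"
        using t by (simp add: power2_eq_square)
      finally show ?thesis .
    qed
    ultimately show "\<exists>m. (?\<psi> has_real_derivative m) (at t) \<and> m \<le> 0"
      by (meson diff_le_0_iff_le)
  qed simp
  then show ?thesis
    by simp
qed

text \<open>A gradient step with step size \<open>1 / L\<close> lowers \<open>g\<close> by at least \<open>(norm (grad g x))\<^sup>2 / (2 * L)\<close>, and the value
reached cannot lie below the infimum.\<close>

lemma L_smooth_grad_norm_bound:
  fixes g :: "'a::euclidean_space \<Rightarrow> real"
  assumes "L_smooth L g" "L > 0" "bdd_below (range g)"
  shows "(norm (grad g x))\<^sup>2 \<le> 2 * L * (g x - (INF z. g z))"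
proof -
  let ?G = "grad g x"
  have "(INF z. g z) \<le> g (x - (1 / L) *\<^sub>R ?G)"
    using assms(3) by (simp add: cINF_lower)
  also have "\<dots> \<le> g x + ?G \<bullet> (- ((1 / L) *\<^sub>R ?G)) + L / 2 * (norm (- ((1 / L) *\<^sub>R ?G)))\<^sup>2"
    using L_smooth_upper_bound [OF assms(1), of "x - (1 / L) *\<^sub>R ?G" x] by simp
  also have "\<dots> = g x - (norm ?G)\<^sup>2 / (2 * L)"
    using assms(2) by (simp add: power_mult_distrib power_divide dot_square_norm field_simps power2_eq_square)
  finally show ?thesis
    using assms(2) by (simp add: field_simps)
qed

section \<open>Attainment of minima of convex functions\<close>

text \<open>Normalise the directions from \<open>x\<close> to points of \<open>S\<close> that run off to infinity and let \<open>u\<close> be a limit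
direction. By convexity every point at distance \<open>t\<close> from \<open>x\<close> in one of the late directions lies
in \<open>S\<close>, and closedness transfers this to \<open>u\<close>.\<close>

lemma unbounded_closed_convex_contains_ray:
  fixes S :: "'a::euclidean_space set"
  assumes "closed S" "convex S" "\<not> bounded S" "x \<in> S"
  obtains u where "norm u = 1" "\<And>t. t \<ge> 0 \<Longrightarrow> x + t *\<^sub>R u \<in> S"
proof -
  have "\<exists>y\<in>S. norm (y - x) > real k" for k
  proof (rule ccontr)
    assume "\<not> (\<exists>y\<in>S. norm (y - x) > real k)"
    then have "S \<subseteq> cball x (real k)"
      by (auto simp: dist_norm norm_minus_commute not_less)
    with assms(3) show False
      by (meson bounded_cball bounded_subset)
  qed
  then obtain y where y: "\<And>k. y k \<in> S" "\<And>k. norm (y k - x) > real k"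
    by metis
  define v where "v k = (1 / norm (y k - x)) *\<^sub>R (y k - x)" for k
  have pos: "norm (y k - x) > 0" for k
    using y(2) [of k] by (meson le_less_trans of_nat_0_le_iff)
  have "v k \<in> sphere 0 1" for k
    using pos [of k] by (simp add: v_def)
  then obtain u r where u: "u \<in> sphere 0 1" "strict_mono r" "(v \<circ> r) \<longlonglongrightarrow> u"
    using compact_sphere [of "0::'a" 1] unfolding compact_def by metis
  have "x + t *\<^sub>R u \<in> S" if "t \<ge> 0" for t
  proof (rule closed_sequentially [OF assms(1)])
    show "(\<lambda>k. x + t *\<^sub>R v (r (k + nat \<lceil>t\<rceil>))) \<longlonglongrightarrow> x + t *\<^sub>R u"
      using LIMSEQ_ignore_initial_segment [OF u(3)] by (intro tendsto_intros) (simp add: o_def)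
    fix k
    \<comment> \<open>Shifting the index by \<open>nat \<lceil>t\<rceil>\<close> makes the point used farther from \<open>x\<close> than \<open>t\<close>.\<close>
    let ?j = "r (k + nat \<lceil>t\<rceil>)"
    have "t \<le> real (k + nat \<lceil>t\<rceil>)"
      by linarith
    also have "\<dots> \<le> real ?j"
      using seq_suble [OF u(2)] by (simp only: of_nat_le_iff)
    also have "\<dots> < norm (y ?j - x)"
      by (rule y)
    finally have less: "t < norm (y ?j - x)" .
    let ?s = "t / norm (y ?j - x)"
    have "(1 - ?s) *\<^sub>R x + ?s *\<^sub>R y ?j \<in> S"
      using less that pos [of ?j] by (intro convexD_alt [OF assms(2)] assms(4) y) auto
    then show "x + t *\<^sub>R v ?j \<in> S"
      by (simp add: v_def algebra_simps)
  qed
  with u(1) show thesis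
    by (intro that [of u]) auto
qed

text \<open>The alternative is whether the sublevel set of \<open>x\<close> is compact or unbounded. To show that a minimum
exists it therefore suffices to exclude directions along which \<open>g\<close> never rises above \<open>g x\<close>, which
is easier than proving coercivity directly.\<close>

lemma convex_attains_min_or_sublevel_ray:
  fixes g :: "'a::euclidean_space \<Rightarrow> real"
  assumes "convex_on UNIV g"
  obtains (min) y where "\<And>z. g y \<le> g z"
    | (ray) u where "norm u = 1" "\<And>t. t \<ge> 0 \<Longrightarrow> g (x + t *\<^sub>R u) \<le> g x"
proof -
  let ?S = "{y. g y \<le> g x}"
  have cont: "continuous_on UNIV g"
    using assms by (simp add: convex_on_continuous)
  have clos: "closed ?S"
    using cont by (simp add: closed_Collect_le)
  have conv: "convex ?S"
  proof (rule convexI)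
    fix a b :: 'a and s t :: real
    assume "a \<in> ?S" "b \<in> ?S" and st: "0 \<le> s" "0 \<le> t" "s + t = 1"
    then have "g (s *\<^sub>R a + t *\<^sub>R b) \<le> s * g a + t * g b"
      using assms by (simp add: convex_on_def)
    also have "\<dots> \<le> s * g x + t * g x"
      using \<open>a \<in> ?S\<close> \<open>b \<in> ?S\<close> st by (intro add_mono mult_left_mono) auto
    also have "\<dots> = g x"
      using st by (simp flip: distrib_right)
    finally show "s *\<^sub>R a + t *\<^sub>R b \<in> ?S"
      by simp
  qed
  show thesis
  proof (cases "bounded ?S")
    case True
    with clos have "compact ?S"
      by (simp add: compact_eq_bounded_closed)
    moreover have "continuous_on ?S g"
      using cont continuous_on_subset by blast
    ultimately obtain y where "y \<in> ?S" "\<And>z. z \<in> ?S \<Longrightarrow> g y \<le> g z"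
      using continuous_attains_inf [of ?S g] by blast
    then have "g y \<le> g z" for z
      by (cases "z \<in> ?S") fastforce+
    then show thesis
      by (rule min)
  next
    case False
    with unbounded_closed_convex_contains_ray [OF clos conv, of x] show thesis
      using ray by auto
  qed
qed

section \<open>Fixed points for a positive definite operator below the identity\<close>

text \<open>The operator \<open>W \<otimes> I\<close> enters the existence and optimality arguments only through these properties.
The fixed vectors of \<open>T\<close> play the role of the consensus vectors, and the \<^emph>\<open>gap\<close>
\<open>T y \<bullet> (y - T y)\<close> is the quadratic form \<open>x \<bullet> (T\<^sup>-\<^sup>1 x - x)\<close> at \<open>x = T y\<close>, written without the inverse.\<close>

locale averaging_operator =
  fixes T :: "'a::euclidean_space \<Rightarrow> 'a"
  assumes lin: "linear T"
    and selfadjoint: "T x \<bullet> y = x \<bullet> T y"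
    and pos: "x \<noteq> 0 \<Longrightarrow> x \<bullet> T x > 0"
    and le_id: "x \<bullet> T x \<le> x \<bullet> x"
begin

lemma nonneg: "x \<bullet> T x \<ge> 0"
  using pos [of x] linear_0 [OF lin] by (cases "x = 0") auto

lemma inj_eq: "T x = T y \<Longrightarrow> x = y"
  using pos [of "x - y"] by (force simp: linear_diff [OF lin])

text \<open>This is the operator identity \<open>T - T\<^sup>2 = (I - T) T (I - T) + T (I - T) T\<close>. It exhibits the gap as a sum
of two nonnegative terms without any appeal to eigenvalues; since \<open>T\<close> is positive definite, the first
term alone detects whether \<open>T y = y\<close>.\<close>

lemma gap_eq:
  "T y \<bullet> (y - T y) = (y - T y) \<bullet> T (y - T y) + (T y \<bullet> T y - T y \<bullet> T (T y))"
  using selfadjoint [of y "T y"] selfadjoint [of y y]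
  by (simp add: linear_diff [OF lin] inner_diff_left inner_diff_right inner_commute)

lemma gap_nonneg: "T y \<bullet> (y - T y) \<ge> 0"
  using nonneg [of "y - T y"] le_id [of "T y"] by (simp add: gap_eq)

lemma gap_eq_0_imp_fixed: "T y \<bullet> (y - T y) = 0 \<Longrightarrow> T y = y"
  using pos [of "y - T y"] le_id [of "T y"] by (force simp: gap_eq)

lemma fixed_inner_gap: "T z = z \<Longrightarrow> z \<bullet> (y - T y) = 0"
  using selfadjoint [of z y] by (simp add: inner_diff_right)

text \<open>With \<open>y = x - \<alpha> *\<^sub>R G x\<close> a fixed point is \<open>x = T y\<close>, so its gradient is \<open>- (y - T y) / \<alpha>\<close>. This vector is
orthogonal to the fixed vectors of \<open>T\<close>, and its inner product with \<open>x\<close> is minus the gap divided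
by \<open>\<alpha>\<close>. Hence moving from \<open>x\<close> to \<open>z\<close> does not decrease the linearisation of \<open>F\<close> at \<open>x\<close>.\<close>

lemma fixed_point_le_consensus:
  assumes "convex_on UNIV F" and "\<And>x. GDERIV F x :> G x"
    and "\<alpha> > 0" and fp: "x = T (x - \<alpha> *\<^sub>R G x)" and z: "T z = z"
  shows "F x \<le> F z"
proof -
  define y where "y = x - \<alpha> *\<^sub>R G x"
  have x: "x = T y" and G: "\<alpha> *\<^sub>R G x = - (y - T y)"
    using fp by (simp_all add: y_def)
  have "\<alpha> * (G x \<bullet> (z - x)) = (\<alpha> *\<^sub>R G x) \<bullet> (z - x)"
    by simp
  also have "\<dots> = T y \<bullet> (y - T y) - z \<bullet> (y - T y)"
    unfolding G unfolding x by (simp add: inner_diff_left inner_diff_right inner_commute)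
  also have "\<dots> \<ge> 0"
    using gap_nonneg [of y] by (simp add: fixed_inner_gap [OF z])
  finally have "G x \<bullet> (z - x) \<ge> 0"
    using \<open>\<alpha> > 0\<close> by (simp add: zero_le_mult_iff)
  then show ?thesis
    using convex_above_tangent [OF assms(1,2), of x z] by simp
qed

text \<open>The vector \<open>\<alpha> *\<^sub>R G x\<close> depends linearly on \<open>y = x - \<alpha> *\<^sub>R G x\<close> for fixed points \<open>x = T y\<close>, so the
difference of two of them pairs with \<open>x - x'\<close> to minus a gap. A strictly monotone gradient is thus
incompatible with two fixed points.\<close>

lemma fixed_points_grad_antimono:
  assumes "\<alpha> > 0" and "x = T (x - \<alpha> *\<^sub>R G x)" "x' = T (x' - \<alpha> *\<^sub>R G x')"
  shows "(G x - G x') \<bullet> (x - x') \<le> 0"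
proof -
  define e where "e = (x - \<alpha> *\<^sub>R G x) - (x' - \<alpha> *\<^sub>R G x')"
  have Te: "T e = x - x'"
    using assms(2,3) by (simp add: e_def linear_diff [OF lin])
  have "\<alpha> *\<^sub>R (G x - G x') = - (e - T e)"
    unfolding Te by (simp add: e_def algebra_simps)
  then have "\<alpha> * ((G x - G x') \<bullet> (x - x')) = - (e - T e) \<bullet> T e"
    by (metis inner_scaleR_left Te)
  also have "\<dots> \<le> 0"
    using gap_nonneg [of e] by (simp add: inner_diff_left inner_diff_right inner_commute)
  finally show ?thesis
    using \<open>\<alpha> > 0\<close> by (simp add: mult_le_0_iff)
qed

lemma convex_gap: "convex_on UNIV (\<lambda>y. T y \<bullet> (y - T y))"
proof (rule convex_onI)
  fix t :: real and a b :: 'a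
  assume t: "0 < t" "t < 1"
  let ?q = "\<lambda>y. T y \<bullet> (y - T y)"
  have sym: "T a \<bullet> (b - T b) = T b \<bullet> (a - T a)"
    by (metis inner_commute inner_diff_right selfadjoint)
  \<comment> \<open>The convexity defect of a quadratic form is a multiple of the form at the difference.\<close>
  have "(1 - t) * ?q a + t * ?q b - ?q ((1 - t) *\<^sub>R a + t *\<^sub>R b) = t * (1 - t) * ?q (a - b)"
    using sym
    by (simp add: linear_add [OF lin] linear_diff [OF lin] linear_scale [OF lin]
        inner_simps algebra_simps)
  moreover have "\<dots> \<ge> 0"
    using t gap_nonneg by simp
  ultimately show "?q ((1 - t) *\<^sub>R a + t *\<^sub>R b) \<le> (1 - t) * ?q a + t * ?q b"
    by linarith
qed simp

lemma GDERIV_gap: "GDERIV (\<lambda>y. T y \<bullet> (y - T y)) y :> 2 *\<^sub>R T (y - T y)"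
proof -
  have dT: "(T has_derivative T) (at y)"
    using lin by (simp add: linear_imp_has_derivative)
  have "((\<lambda>y. T y \<bullet> (y - T y)) has_derivative (\<lambda>h. T y \<bullet> (h - T h) + T h \<bullet> (y - T y))) (at y)"
    by (intro derivative_intros dT)
  moreover have "T y \<bullet> (h - T h) + T h \<bullet> (y - T y) = h \<bullet> (2 *\<^sub>R T (y - T y))" for h
    using selfadjoint [of h y] selfadjoint [of h "T y"] selfadjoint [of y "T h"]
    by (simp add: linear_diff [OF lin] inner_diff_left inner_diff_right inner_commute)
  ultimately show ?thesis
    by (simp add: gderiv_def)
qed

text \<open>Fixed points are the images \<open>x = T y\<close> of the stationary points of the convex function
\<open>\<Phi> y = F (T y) + T y \<bullet> (y - T y) / (2 * \<alpha>)\<close>: its gradient is \<open>T\<close> applied to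
\<open>G (T y) + (y - T y) / \<alpha>\<close>, and \<open>T\<close> is injective.

A minimiser of \<open>\<Phi>\<close> exists because \<open>\<Phi>\<close> stays below \<open>\<Phi> z\<close> along no ray from \<open>z\<close>. On such a ray the
gap is \<open>t\<^sup>2\<close> times the gap of the direction \<open>u\<close>. As \<open>F\<close> is bounded below, the gap of \<open>u\<close> has to vanish;
then the whole ray consists of fixed vectors with \<open>F \<le> F z\<close>, of which there is only a bounded set.\<close>

lemma fixed_point_exists:
  assumes conv: "convex_on UNIV F" and diff: "\<And>x. GDERIV F x :> G x"
    and bdd: "bdd_below (range F)" and "\<alpha> > 0"
    and z: "T z = z"
    and bounded: "bounded {v. T v = v \<and> F v \<le> F z}"
  shows "\<exists>x. x = T (x - \<alpha> *\<^sub>R G x)"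
proof -
  define q where "q y = T y \<bullet> (y - T y)" for y
  define \<Phi> where "\<Phi> y = F (T y) + 1 / (2 * \<alpha>) * q y" for y
  have dT: "(T has_derivative T) (at y)" for y
    using lin by (simp add: linear_imp_has_derivative)
  have convFT: "convex_on UNIV (\<lambda>y. F (T y))"
    using convex_onD [OF conv]
    by (intro convex_onI) (simp_all add: linear_add [OF lin] linear_scale [OF lin])
  have "convex_on UNIV \<Phi>"
    unfolding \<Phi>_def q_def using \<open>\<alpha> > 0\<close> convFT convex_gap
    by (intro convex_on_add convex_on_cmul) auto
  moreover have False if u: "norm u = 1" and ray: "\<And>t. t \<ge> 0 \<Longrightarrow> \<Phi> (z + t *\<^sub>R u) \<le> \<Phi> z" for u
  proof -
    have qz: "q (z + t *\<^sub>R u) = t\<^sup>2 * q u" for t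
      using z selfadjoint [of z u]
      by (simp add: q_def linear_add [OF lin] linear_scale [OF lin] inner_simps algebra_simps
          power2_eq_square inner_commute)
    have below: "F (T (z + t *\<^sub>R u)) + t\<^sup>2 * (q u / (2 * \<alpha>)) \<le> F z" if "t \<ge> 0" for t
      using ray [OF that] qz [of t] qz [of 0] z by (simp add: \<Phi>_def)
    obtain m where m: "\<And>v. m \<le> F v"
      using bdd by (auto simp: bdd_below_def)
    have "q u = 0"
    proof (rule ccontr)
      assume "q u \<noteq> 0"
      then have "q u / (2 * \<alpha>) > 0"
        using gap_nonneg [of u] \<open>\<alpha> > 0\<close> by (simp add: q_def less_le)
      then obtain k where k: "real k * (q u / (2 * \<alpha>)) > F z - m"
        using ex_less_of_nat_mult by blast
      have "real k \<le> (real k)\<^sup>2"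
        by (metis numeral_nat(7) of_nat_le_iff of_nat_power power2_nat_le_imp_le le_square power2_eq_square)
      then have "real k * (q u / (2 * \<alpha>)) \<le> (real k)\<^sup>2 * (q u / (2 * \<alpha>))"
        using \<open>q u / (2 * \<alpha>) > 0\<close> by (intro mult_right_mono) auto
      with k below [of "real k"] m [of "T (z + real k *\<^sub>R u)"] show False
        by simp
    qed
    then have Tu: "T u = u"
      using gap_eq_0_imp_fixed by (simp add: q_def)
    have fixed: "T (z + t *\<^sub>R u) = z + t *\<^sub>R u" for t
      by (simp add: linear_add [OF lin] linear_scale [OF lin] z Tu)
    obtain B where B: "\<And>v. T v = v \<Longrightarrow> F v \<le> F z \<Longrightarrow> norm v \<le> B"
      using bounded by (auto simp: bounded_iff)
    let ?t = "\<bar>B\<bar> + norm z + 1"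
    have "norm (z + ?t *\<^sub>R u) \<le> B"
      using below [of ?t] \<open>q u = 0\<close> by (intro B fixed) (simp add: fixed)
    moreover have "norm (z + ?t *\<^sub>R u) \<ge> norm (?t *\<^sub>R u) - norm z"
      by (metis add.commute norm_diff_ineq)
    moreover have "norm (?t *\<^sub>R u) = ?t"
      using u by simp
    ultimately show False
      by linarith
  qed
  ultimately obtain y where y: "\<And>v. \<Phi> y \<le> \<Phi> v"
    using convex_attains_min_or_sublevel_ray [where g = \<Phi> and x = z] by metis
  have dq: "(q has_derivative (\<lambda>h. h \<bullet> (2 *\<^sub>R T (y - T y)))) (at y)"
    using GDERIV_gap [of y] by (simp add: q_def [abs_def] gderiv_def)
  have dFT: "((\<lambda>y. F (T y)) has_derivative (\<lambda>h. T h \<bullet> G (T y))) (at y)"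
    using has_derivative_compose [OF dT, of F "\<lambda>h. h \<bullet> G (T y)"] diff [of "T y"]
    by (simp add: gderiv_def)
  have "(\<Phi> has_derivative (\<lambda>h. T h \<bullet> G (T y) + 1 / (2 * \<alpha>) * (h \<bullet> (2 *\<^sub>R T (y - T y))))) (at y)"
    unfolding \<Phi>_def using dFT dq by (intro derivative_intros)
  then have "(\<lambda>h. T h \<bullet> G (T y) + 1 / (2 * \<alpha>) * (h \<bullet> (2 *\<^sub>R T (y - T y)))) = (\<lambda>h. 0)"
    using y by (intro has_derivative_local_min) auto
  then have "T h \<bullet> G (T y) + 1 / (2 * \<alpha>) * (h \<bullet> (2 *\<^sub>R T (y - T y))) = 0" for h
    by meson
  then have "\<alpha> * (T h \<bullet> G (T y)) + T h \<bullet> (y - T y) = 0" for h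
    using \<open>\<alpha> > 0\<close> by (simp add: selfadjoint [symmetric] field_simps)
  then have "h \<bullet> T (\<alpha> *\<^sub>R G (T y) + (y - T y)) = 0" for h
    by (simp add: selfadjoint [symmetric] inner_add_right)
  then have "T (\<alpha> *\<^sub>R G (T y) + (y - T y)) = 0"
    by (metis inner_eq_zero_iff)
  then have "\<alpha> *\<^sub>R G (T y) + (y - T y) = 0"
    using inj_eq linear_0 [OF lin] by metis
  then have "T y - \<alpha> *\<^sub>R G (T y) = y"
    by (simp add: algebra_simps)
  then show ?thesis
    by metis
qed

end

section \<open>The spectrum of a real symmetric matrix\<close>

lemma inner_matrix_vector_symmetric:
  fixes A :: "real^'n^'n"
  assumes "transpose A = A"
  shows "(A *v x) \<bullet> y = x \<bullet> (A *v y)"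
  by (metis assms dot_lmul_matrix vector_transpose_matrix inner_commute)

text \<open>A maximiser \<open>u\<close> of the Rayleigh quotient on the unit sphere of \<open>S\<close> is an eigenvector: the form \<open>q\<close>
below is nonnegative on \<open>S\<close> and vanishes at \<open>u\<close>, so its first-order variation at \<open>u\<close> in the
direction of the residual \<open>w = A *v u - c *\<^sub>R u\<close> vanishes, which says \<open>w \<bullet> w = 0\<close>.\<close>

lemma symmetric_has_eigenvector_in_invariant_subspace:
  fixes A :: "real^'n^'n"
  assumes sym: "transpose A = A" and S: "subspace S" and inv: "\<And>v. v \<in> S \<Longrightarrow> A *v v \<in> S"
    and nz: "v \<in> S" "v \<noteq> 0"
  obtains u c where "u \<in> S" "norm u = 1" "A *v u = c *\<^sub>R u"
proof -
  let ?K = "S \<inter> sphere 0 1"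
  have "compact ?K"
    using S by (simp add: closed_subspace closed_Int_compact)
  moreover have "(1 / norm v) *\<^sub>R v \<in> ?K"
    using nz S by (simp add: subspace_scale)
  then have "?K \<noteq> {}"
    by blast
  moreover have "continuous_on ?K (\<lambda>w. w \<bullet> (A *v w))"
    by (intro continuous_intros linear_continuous_on matrix_vector_mul_bounded_linear)
  ultimately obtain u where u: "u \<in> ?K" and max: "\<And>w. w \<in> ?K \<Longrightarrow> w \<bullet> (A *v w) \<le> u \<bullet> (A *v u)"
    using continuous_attains_sup [of ?K "\<lambda>w. w \<bullet> (A *v w)"] by blast
  define c where "c = u \<bullet> (A *v u)"
  define q where "q w = c * (w \<bullet> w) - w \<bullet> (A *v w)" for w
  have uS: "u \<in> S" and uu: "u \<bullet> u = 1"
    using u by (auto simp: norm_eq_1)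
  have q_nonneg: "q w \<ge> 0" if "w \<in> S" for w
  proof (cases "w = 0")
    case False
    have "(1 / norm w) *\<^sub>R w \<in> ?K"
      using that False S by (simp add: subspace_scale)
    from max [OF this] False show ?thesis
      by (simp add: q_def c_def matrix_vector_mult_scaleR dot_square_norm field_simps power2_eq_square)
  qed (simp add: q_def)
  define w where "w = A *v u - c *\<^sub>R u"
  have wS: "w \<in> S"
    using uS S inv by (simp add: w_def subspace_diff subspace_scale)
  have uw: "u \<bullet> w = 0"
    by (simp add: w_def inner_diff_right uu c_def)
  then have Auw: "(A *v u) \<bullet> w = w \<bullet> w"
    by (simp add: w_def inner_diff_left inner_diff_right inner_commute)
  have quad: "0 \<le> t\<^sup>2 * q w - 2 * t * (w \<bullet> w)" for t
  proof -
    have "u + t *\<^sub>R w \<in> S"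
      using uS wS S by (simp add: subspace_add subspace_scale)
    then have "0 \<le> q (u + t *\<^sub>R w)"
      by (rule q_nonneg)
    also have "\<dots> = t\<^sup>2 * q w - 2 * t * (w \<bullet> w)"
      using uw Auw inner_matrix_vector_symmetric [OF sym, of u w]
      by (simp add: q_def matrix_vector_right_distrib matrix_vector_mult_scaleR inner_add_left
          inner_add_right uu c_def [symmetric] inner_commute power2_eq_square algebra_simps)
    finally show ?thesis .
  qed
  have "w = 0"
  proof (rule ccontr)
    assume "w \<noteq> 0"
    then have pos: "w \<bullet> w > 0"
      by simp
    \<comment> \<open>A step small enough for the linear term to dominate; the \<open>1\<close> guards against \<open>q w = 0\<close>.\<close>
    let ?t = "(w \<bullet> w) / (q w + 1)"
    have "q w \<ge> 0"
      using wS by (rule q_nonneg)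
    then have t: "?t > 0" "?t * q w < w \<bullet> w"
      using pos by (simp_all add: field_simps)
    then have "?t * q w - 2 * (w \<bullet> w) < 0"
      using pos by linarith
    then have "?t * (?t * q w - 2 * (w \<bullet> w)) < 0"
      using t(1) by (rule mult_pos_neg [rotated])
    with quad [of ?t] show False
      by (simp add: power2_eq_square algebra_simps)
  qed
  then have "A *v u = c *\<^sub>R u"
    by (simp add: w_def)
  with u that show thesis
    by auto
qed

text \<open>The spectral theorem, by splitting off one eigenvector at a time. It is stated for an invariant
subspace because it is needed on the orthogonal complement of the all-one vector, whose eigenvalue
has to be kept apart from the others.\<close>

lemma symmetric_orthonormal_eigenbasis:
  fixes A :: "real^'n^'n"
  assumes sym: "transpose A = A" and "subspace S" and "\<And>v. v \<in> S \<Longrightarrow> A *v v \<in> S"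
  shows "\<exists>B. B \<subseteq> S \<and> pairwise orthogonal B \<and> (\<forall>b\<in>B. norm b = 1) \<and> span B = S
           \<and> (\<forall>b\<in>B. \<exists>c. A *v b = c *\<^sub>R b)"
  using assms(2,3)
proof (induction "dim S" arbitrary: S rule: less_induct)
  case less
  show ?case
  proof (cases "S = {0}")
    case True
    then show ?thesis
      by (intro exI [of _ "{}"]) auto
  next
    case False
    then obtain v where "v \<in> S" "v \<noteq> 0"
      using less.prems(1) subspace_0 by blast
    then obtain u c where u: "u \<in> S" "norm u = 1" "A *v u = c *\<^sub>R u"
      using symmetric_has_eigenvector_in_invariant_subspace [OF sym less.prems] by metis
    let ?S' = "S \<inter> {x. u \<bullet> x = 0}"
    have sub: "subspace ?S'"
      using less.prems(1) subspace_hyperplane by (rule subspace_inter)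
    have "u \<notin> ?S'"
      using u by (auto simp: norm_eq_1)
    then have "?S' \<subset> S"
      using u by blast
    then have "dim ?S' < dim S"
      using sub less.prems(1) by (metis dim_psubset span_eq_iff)
    moreover have "A *v x \<in> ?S'" if "x \<in> ?S'" for x
      using that less.prems(2) inner_matrix_vector_symmetric [OF sym, of u x] u(3) by simp
    ultimately obtain B where B: "B \<subseteq> ?S'" "pairwise orthogonal B" "\<forall>b\<in>B. norm b = 1"
        "span B = ?S'" "\<forall>b\<in>B. \<exists>c. A *v b = c *\<^sub>R b"
      using less.hyps [OF _ sub] by metis
    have "S \<subseteq> span (insert u B)"
    proof
      fix x assume "x \<in> S"
      let ?y = "x - (u \<bullet> x) *\<^sub>R u"
      have "?y \<in> ?S'"
        using \<open>x \<in> S\<close> u less.prems(1)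
        by (auto simp: subspace_diff subspace_scale inner_diff_right norm_eq_1)
      then have "?y \<in> span B"
        using B(4) by simp
      then show "x \<in> span (insert u B)"
        by (auto simp: span_breakdown_eq)
    qed
    moreover have "span (insert u B) \<subseteq> S"
      using B(1) u(1) less.prems(1) by (intro span_minimal) auto
    moreover have "pairwise orthogonal (insert u B)"
      using B(1,2) by (auto simp: pairwise_insert orthogonal_def inner_commute)
    ultimately show ?thesis
      using B u by (intro exI [of _ "insert u B"]) auto
  qed
qed

lemma poly_det:
  fixes M :: "real poly^'n^'n"
  shows "poly (det M) t = det (\<chi> i j. poly (M $ i $ j) t)"
  by (simp add: det_def poly_sum poly_prod)

text \<open>Conjugation by the orthogonal matrix with columns \<open>b i\<close> diagonalises \<open>t I - A\<close>. Evaluating at all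
real \<open>t\<close> first keeps the computation with matrices over a field instead of matrices of polynomials.\<close>

lemma charpoly_orthonormal_eigenbasis:
  fixes A :: "real^'n^'n" and b :: "'n \<Rightarrow> real^'n"
  assumes orth: "\<And>i j. b i \<bullet> b j = (if i = j then 1 else 0)"
    and eig: "\<And>i. A *v b i = d i *\<^sub>R b i"
  shows "charpoly A = (\<Prod>i\<in>UNIV. [:- d i, 1:])"
proof -
  define Q :: "real^'n^'n" where "Q = (\<chi> i j. b j $ i)"
  have Q: "transpose Q ** Q = mat 1"
    using orth by (simp add: Q_def matrix_mult_transpose_dot_column column_def mat_def vec_eq_iff)
  have "poly (charpoly A) t = poly (\<Prod>i\<in>UNIV. [:- d i, 1:]) t" for t
  proof -
    have "poly (charpoly A) t = det (mat t - A)"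
      unfolding charpoly_def poly_det
      by (rule arg_cong [of _ _ det]) (simp add: vec_eq_iff mat_def)
    also have "\<dots> = det (transpose Q) * det (mat t - A) * det Q"
      using arg_cong [OF Q, of det] by (simp add: det_mul)
    also have "\<dots> = det (transpose Q ** ((mat t - A) ** Q))"
      by (simp add: det_mul)
    also have "transpose Q ** ((mat t - A) ** Q) = (\<chi> i j. if i = j then t - d i else 0)"
    proof -
      have "column j ((mat t - A) ** Q) = (t - d j) *\<^sub>R b j" for j
      proof -
        have "mat t *v b j = t *\<^sub>R b j"
          by (simp add: vec_eq_iff matrix_vector_mult_def mat_def if_distrib [of "\<lambda>c. c * _"] cong: if_cong)
        moreover have "column j ((mat t - A) ** Q) = (mat t - A) *v b j"
          by (simp add: vec_eq_iff column_def Q_def matrix_matrix_mult_def matrix_vector_mult_def)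
        ultimately show ?thesis
          by (simp add: matrix_vector_mult_diff_rdistrib eig algebra_simps)
      qed
      moreover have "column i Q = b i" for i
        by (simp add: column_def Q_def vec_eq_iff)
      moreover have "(transpose Q ** M) $ i $ j = column i Q \<bullet> column j M" for i j and M :: "real^'n^'n"
        by (simp add: matrix_matrix_mult_def transpose_def column_def inner_vec_def)
      ultimately show ?thesis
        using orth by (simp add: vec_eq_iff [of "transpose Q ** _"] vec_eq_iff [of "_ $ _"])
    qed
    also have "det \<dots> = (\<Prod>i\<in>UNIV. t - d i)"
      by (subst det_diagonal) auto
    finally show ?thesis
      by (simp add: poly_prod)
  qed
  then show ?thesis
    by (simp add: poly_eq_poly_eq_iff [symmetric] fun_eq_iff)
qed

lemma proots_prod_linear:
  fixes d :: "'n \<Rightarrow> 'a::idom"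
  shows "finite I \<Longrightarrow> proots (\<Prod>i\<in>I. [:- d i, 1:]) = image_mset d (mset_set I)"
proof (induction I rule: finite_induct)
  case (insert x F)
  have "(\<Prod>i\<in>F. [:- d i, 1:]) \<noteq> 0"
    using insert.hyps by (simp add: prod_zero_iff)
  with insert show ?case
    by (simp add: proots_mult del: mult_pCons_left)
qed simp


section \<open>The spectral gap of an averaging matrix\<close>

text \<open>The quadratic form of the graph Laplacian \<open>I - W\<close> as a weighted sum over edges. It shows both that \<open>W\<close>
is dominated by the identity and, on a connected graph, that only constant vectors attain equality.\<close>

lemma symmetric_stochastic_quadratic_form:
  fixes W :: "real^'n^'n"
  assumes sym: "transpose W = W" and stoch: "W *v vec 1 = vec 1"
  shows "v \<bullet> v - v \<bullet> (W *v v) = (\<Sum>i\<in>UNIV. \<Sum>j\<in>UNIV. W $ i $ j * (v $ i - v $ j)\<^sup>2) / 2"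
proof -
  have row: "(\<Sum>j\<in>UNIV. W $ i $ j) = 1" for i
    using arg_cong [OF stoch, of "\<lambda>u. u $ i"] by (simp add: matrix_vector_mult_def)
  have "W $ j $ i = W $ i $ j" for i j
    using arg_cong [OF sym, of "\<lambda>A. A $ i $ j"] by (simp add: transpose_def)
  then have swap: "(\<Sum>i\<in>UNIV. \<Sum>j\<in>UNIV. W $ i $ j * (v $ j)\<^sup>2) = (\<Sum>i\<in>UNIV. \<Sum>j\<in>UNIV. W $ i $ j * (v $ i)\<^sup>2)"
    by (subst sum.swap) simp
  have diag: "(\<Sum>i\<in>UNIV. \<Sum>j\<in>UNIV. W $ i $ j * (v $ i)\<^sup>2) = v \<bullet> v"
    by (simp add: inner_vec_def row power2_eq_square flip: sum_distrib_right)
  have cross: "(\<Sum>i\<in>UNIV. \<Sum>j\<in>UNIV. W $ i $ j * (v $ i * v $ j)) = v \<bullet> (W *v v)"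
    by (simp add: inner_vec_def matrix_vector_mult_def sum_distrib_left mult_ac)
  have "(\<Sum>i\<in>UNIV. \<Sum>j\<in>UNIV. W $ i $ j * (v $ i - v $ j)\<^sup>2)
      = (\<Sum>i\<in>UNIV. \<Sum>j\<in>UNIV. W $ i $ j * (v $ i)\<^sup>2) + (\<Sum>i\<in>UNIV. \<Sum>j\<in>UNIV. W $ i $ j * (v $ j)\<^sup>2)
        - 2 * (\<Sum>i\<in>UNIV. \<Sum>j\<in>UNIV. W $ i $ j * (v $ i * v $ j))"
    by (simp add: power2_eq_square algebra_simps sum.distrib sum_subtractf sum_distrib_left)
  also have "\<dots> = 2 * (v \<bullet> v) - 2 * (v \<bullet> (W *v v))"
    by (simp add: swap diag cross)
  finally show ?thesis
    by simp
qed

lemma averaging_matrix_le_id: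
  assumes "averaging_matrix E W"
  shows "v \<bullet> (W *v v) \<le> v \<bullet> v"
proof -
  have "v \<bullet> v - v \<bullet> (W *v v) \<ge> 0"
    using assms by (subst symmetric_stochastic_quadratic_form) (auto simp: averaging_matrix_def intro!: sum_nonneg)
  then show ?thesis
    by simp
qed

lemma averaging_matrix_fixed_imp_constant:
  assumes "averaging_matrix E W" "graph_connected E" and eq: "v \<bullet> (W *v v) = v \<bullet> v"
  shows "v $ i = v $ j"
proof -
  have nonneg: "W $ a $ b * (v $ a - v $ b)\<^sup>2 \<ge> 0" for a b
    using assms(1) by (simp add: averaging_matrix_def)
  have "(\<Sum>a\<in>UNIV. \<Sum>b\<in>UNIV. W $ a $ b * (v $ a - v $ b)\<^sup>2) = 0"
    using assms symmetric_stochastic_quadratic_form [of W v] by (auto simp: averaging_matrix_def)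
  then have zero: "W $ a $ b * (v $ a - v $ b)\<^sup>2 = 0" for a b
    using nonneg by (simp add: sum_nonneg_eq_0_iff sum_nonneg)
  have edge: "v $ a = v $ b" if "{a, b} \<in> E" for a b
  proof -
    have "W $ a $ b \<noteq> 0"
      using assms(1) that by (auto simp: averaging_matrix_def)
    with zero [of a b] show ?thesis
      by simp
  qed
  have "(i, j) \<in> {(a, b). {a, b} \<in> E}\<^sup>*"
    using assms(2) by (simp add: graph_connected_def)
  then show ?thesis
    by (induction rule: rtrancl_induct) (auto dest: edge)
qed

lemma rev_sorted_list_add_max:
  fixes M :: "'a::linorder multiset"
  assumes "\<And>x. x \<in># M \<Longrightarrow> x \<le> m"
  shows "rev (sorted_list_of_multiset (add_mset m M)) = m # rev (sorted_list_of_multiset M)"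
  using assms by (simp add: sorted_insort_is_snoc)

lemma rev_sorted_list_first_is_max:
  fixes M :: "'a::linorder multiset"
  assumes "x \<in># M"
  shows "x \<le> rev (sorted_list_of_multiset M) ! 0"
proof -
  let ?ys = "sorted_list_of_multiset M"
  have "x \<in> set ?ys"
    using assms by (metis mset_sorted_list_of_multiset set_mset_mset)
  then obtain k where k: "k < length ?ys" "?ys ! k = x"
    by (metis in_set_conv_nth)
  then have "?ys ! k \<le> ?ys ! (length ?ys - 1)"
    by (intro sorted_nth_mono sorted_sorted_list_of_multiset) auto
  moreover have "rev ?ys ! 0 = ?ys ! (length ?ys - 1)"
    using k(1) by (subst rev_nth) auto
  ultimately show ?thesis
    using k(2) by simp
qed

text \<open>On the complement of the all-one vector there is an orthonormal eigenbasis \<open>B\<close> whose eigenvalues lie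
strictly between \<open>0\<close> and \<open>1\<close>: they are positive since \<open>W\<close> is positive definite, and below \<open>1\<close> since
a vector with quotient \<open>1\<close> is constant by connectedness and therefore \<open>0\<close>. Adding the
normalised all-one vector \<open>e\<close> gives a basis of the whole space, so the roots of the characteristic
polynomial are \<open>1\<close> together with the eigenvalues on \<open>B\<close>. In descending order \<open>1\<close> comes first, the
second entry is the largest eigenvalue on \<open>B\<close>, and the last entry is also one on \<open>B\<close>. Hence \<open>\<beta> < 1\<close>,
and \<open>\<beta>\<close> bounds the norm of \<open>W\<close> on the span of \<open>B\<close>.\<close>

theorem averaging_matrix_spectral_gap:
  fixes W :: "real^'n^'n"
  assumes card: "CARD('n) \<ge> 2" and conn: "graph_connected E" and avg: "averaging_matrix E W"
    and pd: "positive_definite W"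
  defines "\<beta> \<equiv> max \<bar>nth_eigenvalue 2 W\<bar> \<bar>nth_eigenvalue CARD('n) W\<bar>"
  shows "0 \<le> \<beta>" and "\<beta> < 1" and "(\<Sum>i\<in>UNIV. v $ i) = 0 \<Longrightarrow> norm (W *v v) \<le> \<beta> * norm v"
proof -
  have sym: "transpose W = W" and stoch: "W *v 1 = 1"
    using avg by (simp_all add: averaging_matrix_def)
  let ?S = "{v :: real^'n. 1 \<bullet> v = 0}"
  have S: "subspace ?S"
    by (rule subspace_hyperplane)
  have inv: "W *v v \<in> ?S" if "v \<in> ?S" for v
    using that inner_matrix_vector_symmetric [OF sym, of "1" v] by (simp add: stoch)
  obtain B where B: "B \<subseteq> ?S" "pairwise orthogonal B" "\<And>b. b \<in> B \<Longrightarrow> norm b = 1" "span B = ?S"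
      "\<And>b. b \<in> B \<Longrightarrow> \<exists>c. W *v b = c *\<^sub>R b"
    using symmetric_orthonormal_eigenbasis [OF sym S inv] by metis
  \<comment> \<open>The Rayleigh quotient of a unit vector, a choice-free name for its eigenvalue.\<close>
  define ev where "ev b = b \<bullet> (W *v b)" for b
  have ev: "W *v b = ev b *\<^sub>R b" if "b \<in> B" for b
    using B(3,5) [OF that] by (auto simp: ev_def norm_eq_1)
  have ev_pos: "0 < ev b" if "b \<in> B" for b
    using pd B(3) [OF that] by (auto simp: positive_definite_def ev_def dest: spec [of _ b])
  have ev_less: "ev b < 1" if "b \<in> B" for b
  proof -
    have bb: "b \<bullet> b = 1"
      using B(3) [OF that] by (simp add: norm_eq_1)
    have "ev b \<noteq> 1"
    proof
      assume "ev b = 1"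
      then have "b \<bullet> (W *v b) = b \<bullet> b"
        by (simp add: ev_def bb)
      then have "b $ i = b $ j" for i j
        by (rule averaging_matrix_fixed_imp_constant [OF avg conn])
      then have "b = (b $ undefined) *\<^sub>R 1"
        by (simp add: vec_eq_iff)
      moreover have "1 \<bullet> b = 0"
        using that B(1) by auto
      ultimately have "b \<bullet> b = 0"
        by (metis inner_scaleR_left mult_zero_right)
      with bb show False
        by simp
    qed
    moreover have "ev b \<le> 1"
      using averaging_matrix_le_id [OF avg, of b] by (simp add: ev_def bb)
    ultimately show ?thesis
      by simp
  qed
  define e :: "real^'n" where "e = (1 / norm (1 :: real^'n)) *\<^sub>R 1"
  have one: "1 \<noteq> (0 :: real^'n)"
    by (simp add: vec_eq_iff)
  then have e: "norm e = 1"
    by (simp add: e_def)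
  have We: "W *v e = e"
    by (simp add: e_def matrix_vector_mult_scaleR stoch)
  then have eve: "ev e = 1"
    using e by (simp add: ev_def norm_eq_1)
  have e_orth: "e \<bullet> v = 0 \<longleftrightarrow> v \<in> ?S" for v
    using one by (simp add: e_def)
  have "e \<notin> B"
    using B(1) e e_orth [of e] by (auto simp: norm_eq_1)
  let ?B = "insert e B"
  have orthB: "pairwise orthogonal ?B"
    using B(1,2) e_orth by (auto simp: pairwise_insert orthogonal_def inner_commute)
  have "0 \<notin> ?B"
    using e B(3) by force
  with orthB have indep: "independent ?B"
    by (rule pairwise_orthogonal_independent)
  then have "finite B"
    using independent_imp_finite [OF indep] by simp
  have "x \<in> span ?B" for x
  proof -
    have "x - (e \<bullet> x) *\<^sub>R e \<in> ?S"
      using e by (subst e_orth [symmetric]) (simp add: inner_diff_right norm_eq_1)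
    then show ?thesis
      using B(4) by (auto simp: span_breakdown_eq)
  qed
  then have "card ?B = CARD('n)"
    using dim_eq_card [of ?B UNIV] indep by (auto simp: set_eq_iff)
  then obtain \<phi> where \<phi>: "bij_betw \<phi> (UNIV :: 'n set) ?B"
    using \<open>finite B\<close> by (metis finite_insert finite_class.finite_UNIV finite_same_card_bij)
  have in_B: "\<phi> i \<in> ?B" for i
    using \<phi> by (auto simp: bij_betw_def)
  have unit: "norm b = 1" if "b \<in> ?B" for b
    using that e B(3) by auto
  have "charpoly W = (\<Prod>i\<in>UNIV. [:- ev (\<phi> i), 1:])"
  proof (rule charpoly_orthonormal_eigenbasis)
    show "\<phi> i \<bullet> \<phi> j = (if i = j then 1 else 0)" for i j
    proof (cases "i = j")
      case True
      then show ?thesis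
        using unit [OF in_B] by (simp add: norm_eq_1)
    next
      case False
      then have "\<phi> i \<noteq> \<phi> j"
        using \<phi> by (auto simp: bij_betw_def inj_def)
      with False show ?thesis
        using pairwiseD [OF orthB in_B in_B, of i j] by (simp add: orthogonal_def)
    qed
    show "W *v \<phi> i = ev (\<phi> i) *\<^sub>R \<phi> i" for i
      using in_B [of i] ev We eve by auto
  qed
  then have "proots (charpoly W) = image_mset (\<lambda>i. ev (\<phi> i)) (mset_set UNIV)"
    by (simp add: proots_prod_linear)
  also have "\<dots> = image_mset ev (image_mset \<phi> (mset_set UNIV))"
    by (simp add: multiset.map_comp o_def)
  also have "image_mset \<phi> (mset_set UNIV) = mset_set ?B"
    using \<phi> by (simp add: bij_betw_def image_mset_mset_set)
  also have "image_mset ev (mset_set ?B) = add_mset 1 (image_mset ev (mset_set B))"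
    using \<open>finite B\<close> \<open>e \<notin> B\<close> eve by simp
  finally have roots: "proots (charpoly W) = add_mset 1 (image_mset ev (mset_set B))" .
  define xs where "xs = rev (sorted_list_of_multiset (image_mset ev (mset_set B)))"
  have eigs: "rev (sorted_list_of_multiset (proots (charpoly W))) = 1 # xs"
    unfolding roots xs_def using \<open>finite B\<close> ev_less by (intro rev_sorted_list_add_max) (auto intro: less_imp_le)
  have set_xs: "set xs = ev ` B"
    using \<open>finite B\<close> by (simp add: xs_def)
  have "length xs = size (mset xs)"
    by simp
  also have "\<dots> = card B"
    by (simp add: xs_def del: size_mset)
  finally have "length xs = card B" .
  then have len: "length xs = CARD('n) - 1"
    using \<open>card ?B = CARD('n)\<close> \<open>finite B\<close> \<open>e \<notin> B\<close> by simp
  have eig2: "nth_eigenvalue 2 W = xs ! 0" and eign: "nth_eigenvalue CARD('n) W = xs ! (CARD('n) - 2)"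
    using card unfolding nth_eigenvalue_def eigs by (simp_all add: nth_Cons' numeral_2_eq_2)
  have "xs ! 0 \<in> ev ` B" "xs ! (CARD('n) - 2) \<in> ev ` B"
    using len card by (auto simp flip: set_xs)
  then have "0 < xs ! 0" "xs ! 0 < 1" "0 < xs ! (CARD('n) - 2)" "xs ! (CARD('n) - 2) < 1"
    using ev_pos ev_less by auto
  then show "0 \<le> \<beta>" "\<beta> < 1"
    by (simp_all add: \<beta>_def eig2 eign)
  have ev_le: "ev b \<le> \<beta>" if "b \<in> B" for b
  proof -
    have "ev b \<le> xs ! 0"
      unfolding xs_def using that \<open>finite B\<close> by (intro rev_sorted_list_first_is_max) simp
    then show ?thesis
      by (simp add: \<beta>_def eig2)
  qed
  show "norm (W *v v) \<le> \<beta> * norm v" if "(\<Sum>i\<in>UNIV. v $ i) = 0" for v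
  proof -
    have "v \<in> span B"
      using that B(4) by (simp add: inner_vec_def)
    then have v: "v = (\<Sum>b\<in>B. (v \<bullet> b) *\<^sub>R b)"
      using orthonormal_basis_expand [OF B(2,3) _ \<open>finite B\<close>] by simp
    have orth: "pairwise (\<lambda>b b'. orthogonal (k b *\<^sub>R b) (k b' *\<^sub>R b')) B" for k :: "real^'n \<Rightarrow> real"
      using B(2) by (auto simp: pairwise_def orthogonal_def)
    have norm_comb: "(norm (\<Sum>b\<in>B. k b *\<^sub>R b))\<^sup>2 = (\<Sum>b\<in>B. (k b)\<^sup>2)" for k
      using norm_sum_Pythagorean [OF \<open>finite B\<close> orth, of k] B(3) by simp
    have "W *v v = (\<Sum>b\<in>B. (ev b * (v \<bullet> b)) *\<^sub>R b)"
      by (subst v) (simp only: linear_sum [OF matrix_vector_mul_linear] matrix_vector_mult_scaleR ev scaleR_scaleR mult.commute cong: sum.cong)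
    then have "(norm (W *v v))\<^sup>2 = (\<Sum>b\<in>B. (ev b * (v \<bullet> b))\<^sup>2)"
      by (simp add: norm_comb)
    also have "\<dots> \<le> (\<Sum>b\<in>B. (\<beta> * (v \<bullet> b))\<^sup>2)"
      unfolding power_mult_distrib using ev_pos ev_le
      by (intro sum_mono mult_right_mono power_mono) (auto intro: less_imp_le)
    also have "\<dots> = \<beta>\<^sup>2 * (\<Sum>b\<in>B. (v \<bullet> b)\<^sup>2)"
      by (simp add: power_mult_distrib sum_distrib_left)
    also have "\<dots> = \<beta>\<^sup>2 * (norm v)\<^sup>2"
      using norm_comb [of "\<lambda>b. v \<bullet> b"] by (simp only: v [symmetric])
    finally have "(norm (W *v v))\<^sup>2 \<le> (\<beta> * norm v)\<^sup>2"
      by (simp add: power_mult_distrib)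
    then show ?thesis
      by (rule power2_le_imp_le) (simp add: \<open>0 \<le> \<beta>\<close>)
  qed
qed

section \<open>Stacked vectors\<close>

text \<open>A stacked vector is a matrix with a row (\<^const>\<open>block\<close>) for each vertex and a column for each coordinate
of \<open>\<real>\<^sup>d\<close>. The cost is separable by rows, whereas \<open>W \<otimes> I\<close> acts on each column by \<open>W\<close>.\<close>

definition coordinate :: "real^('n::finite \<times> 'd::finite) \<Rightarrow> 'd \<Rightarrow> real^'n" where
  "coordinate x k = (\<chi> i. x $ (i, k))"

definition consensus :: "real^'d \<Rightarrow> real^('n::finite \<times> 'd::finite)" where
  "consensus v = (\<chi> p. v $ snd p)"

lemma inner_eq_sum_blocks:
  "x \<bullet> y = (\<Sum>i\<in>UNIV. block x i \<bullet> block y i)"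
  by (simp add: inner_vec_def block_def sum.cartesian_product split_def)

lemma inner_eq_sum_coordinates:
  "x \<bullet> y = (\<Sum>k\<in>UNIV. coordinate x k \<bullet> coordinate y k)"
  unfolding inner_eq_sum_blocks by (simp add: inner_vec_def block_def coordinate_def sum.swap [of _ "UNIV :: 'b set"])

lemma norm_sq_eq_sum_blocks:
  "(norm x)\<^sup>2 = (\<Sum>i\<in>UNIV. (norm (block x i))\<^sup>2)"
  by (simp only: power2_norm_eq_inner inner_eq_sum_blocks)

lemma norm_sq_eq_sum_coordinates:
  "(norm x)\<^sup>2 = (\<Sum>k\<in>UNIV. (norm (coordinate x k))\<^sup>2)"
  by (simp only: power2_norm_eq_inner inner_eq_sum_coordinates)

lemma norm_block_le: "norm (block x i) \<le> norm x"
proof (rule power2_le_imp_le)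
  show "(norm (block x i))\<^sup>2 \<le> (norm x)\<^sup>2"
    unfolding norm_sq_eq_sum_blocks by (rule member_le_sum) auto
qed simp

lemma bounded_linear_block: "bounded_linear (\<lambda>x. block x i)"
  by (rule linear_conv_bounded_linear [THEN iffD1])
     (auto intro!: linearI simp: block_def vec_eq_iff)

lemma bounded_linear_consensus: "bounded_linear consensus"
  by (rule linear_conv_bounded_linear [THEN iffD1])
     (auto intro!: linearI simp: consensus_def vec_eq_iff)

lemma block_add: "block (x + y) i = block x i + block y i"
  and block_diff: "block (x - y) i = block x i - block y i"
  and block_scaleR: "block (c *\<^sub>R x) i = c *\<^sub>R block x i"
  and block_consensus [simp]: "block (consensus v) i = v"
  by (simp_all add: block_def consensus_def vec_eq_iff)

lemma stacked_eqI: "(\<And>i. block x i = block y i) \<Longrightarrow> x = y"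
  by (simp add: block_def vec_eq_iff)

lemma sum_coordinate: "(\<Sum>i\<in>UNIV. coordinate x k $ i) = (\<Sum>i\<in>UNIV. block x i) $ k"
  by (simp add: coordinate_def block_def)

section \<open>Mixing stacked vectors with an averaging matrix\<close>

abbreviation mix :: "real^'n^'n \<Rightarrow> real^('n::finite \<times> 'd::finite) \<Rightarrow> real^('n \<times> 'd)" where
  "mix W x \<equiv> kronecker W (mat 1 :: real^'d^'d) *v x"

lemma coordinate_mix: "coordinate (mix W x) k = W *v coordinate x k"
proof -
  have "(\<Sum>p\<in>UNIV. W $ i $ fst p * (mat 1 :: real^'b^'b) $ k $ snd p * x $ p)
      = (\<Sum>j\<in>UNIV. \<Sum>l\<in>UNIV. W $ i $ j * (mat 1 :: real^'b^'b) $ k $ l * x $ (j, l))" for i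
    by (simp add: sum.cartesian_product split_def)
  also have "\<dots> i = (\<Sum>j\<in>UNIV. W $ i $ j * x $ (j, k))" for i
    by (simp add: mat_def if_distrib [of "\<lambda>c. _ * c"] if_distrib [of "\<lambda>c. c * _"] cong: if_cong)
  finally show ?thesis
    by (simp add: coordinate_def kronecker_def matrix_vector_mult_def vec_eq_iff)
qed

text \<open>All properties are inherited column by column from \<open>W\<close>.\<close>

lemma averaging_operator_mix:
  fixes W :: "real^'n^'n"
  assumes avg: "averaging_matrix E W" and pd: "positive_definite W"
  shows "averaging_operator (mix W :: real^('n \<times> 'd::finite) \<Rightarrow> real^('n \<times> 'd))"
proof (rule averaging_operator.intro)
  have sym: "transpose W = W"
    using avg by (simp add: averaging_matrix_def)
  show "linear (mix W :: real^('n \<times> 'd) \<Rightarrow> real^('n \<times> 'd))"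
    by (rule matrix_vector_mul_linear)
  fix x y :: "real^('n \<times> 'd)"
  show "mix W x \<bullet> y = x \<bullet> mix W y"
    by (simp add: inner_eq_sum_coordinates coordinate_mix inner_matrix_vector_symmetric [OF sym])
  show "x \<bullet> mix W x \<le> x \<bullet> x"
    unfolding inner_eq_sum_coordinates coordinate_mix
    by (intro sum_mono averaging_matrix_le_id [OF avg])
  show "x \<bullet> mix W x > 0" if "x \<noteq> 0"
  proof -
    have pos: "v \<bullet> (W *v v) > 0" if "v \<noteq> 0" for v
      using pd that by (simp add: positive_definite_def)
    then have "v \<bullet> (W *v v) \<ge> 0" for v
      by (cases "v = 0") (auto intro: less_imp_le)
    moreover have "\<exists>k. coordinate x k \<noteq> 0"
      using that by (auto simp: coordinate_def vec_eq_iff)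
    then obtain k where "coordinate x k \<noteq> 0"
      by blast
    ultimately show ?thesis
      unfolding inner_eq_sum_coordinates coordinate_mix
      by (intro sum_pos2 [of _ k] pos) auto
  qed
qed

lemma mix_consensus:
  fixes W :: "real^'n^'n"
  assumes "averaging_matrix E W"
  shows "mix W (consensus v) = consensus v"
proof -
  have stoch: "W *v 1 = 1"
    using assms by (simp add: averaging_matrix_def)
  have "coordinate (consensus v) k = v $ k *\<^sub>R (1 :: real^'n)" for k
    by (simp add: coordinate_def consensus_def vec_eq_iff)
  then have "coordinate (mix W (consensus v)) k = coordinate (consensus v) k" for k
    by (simp add: coordinate_mix matrix_vector_mult_scaleR stoch)
  then show ?thesis
    by (simp add: coordinate_def vec_eq_iff)
qed

lemma mix_fixed_imp_consensus:
  assumes "averaging_matrix E W" "graph_connected E" and fixed: "mix W x = x"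
  shows "x = consensus (block x i)"
proof -
  have "W *v coordinate x k = coordinate x k" for k
    using fixed by (metis coordinate_mix)
  then have "coordinate x k $ j = coordinate x k $ i" for j k
    by (intro averaging_matrix_fixed_imp_constant [OF assms(1,2)]) simp
  then show ?thesis
    by (simp add: consensus_def block_def coordinate_def vec_eq_iff)
qed

text \<open>A symmetric stochastic matrix is doubly stochastic, so mixing preserves the mean.\<close>

lemma sum_block_mix:
  assumes "averaging_matrix E W"
  shows "(\<Sum>i\<in>UNIV. block (mix W x) i) = (\<Sum>i\<in>UNIV. block x i)"
proof -
  have sym: "transpose W = W" and stoch: "W *v 1 = 1"
    using assms by (simp_all add: averaging_matrix_def)
  have "(\<Sum>i\<in>UNIV. (W *v v) $ i) = (\<Sum>i\<in>UNIV. v $ i)" for v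
    using inner_matrix_vector_symmetric [OF sym, of 1 v] by (simp add: stoch inner_vec_def)
  then show ?thesis
    unfolding vec_eq_iff sum_coordinate [symmetric] coordinate_mix by blast
qed

lemma norm_mix_le:
  assumes le: "\<And>v. (\<Sum>i\<in>UNIV. v $ i) = 0 \<Longrightarrow> norm (W *v v) \<le> \<beta> * norm v" and "\<beta> \<ge> 0"
    and "(\<Sum>i\<in>UNIV. block x i) = 0"
  shows "norm (mix W x) \<le> \<beta> * norm x"
proof (rule power2_le_imp_le)
  have "(norm (W *v coordinate x k))\<^sup>2 \<le> (\<beta> * norm (coordinate x k))\<^sup>2" for k
    using assms(3) by (intro power_mono le) (simp_all add: sum_coordinate)
  then show "(norm (mix W x))\<^sup>2 \<le> (\<beta> * norm x)\<^sup>2"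
    unfolding norm_sq_eq_sum_coordinates power_mult_distrib coordinate_mix sum_distrib_left
    by (rule sum_mono)
qed (simp add: \<open>\<beta> \<ge> 0\<close>)

section \<open>The separable cost\<close>

lemma GDERIV_total_cost:
  assumes "\<And>i. f i differentiable_on UNIV"
  shows "GDERIV (total_cost f) x :> (\<chi> p. grad (f (fst p)) (block x (fst p)) $ snd p)"
    (is "GDERIV _ x :> ?D")
proof -
  have "block ?D i = grad (f i) (block x i)" for i
    by (simp add: block_def vec_eq_iff)
  then have "h \<bullet> ?D = (\<Sum>i\<in>UNIV. block h i \<bullet> grad (f i) (block x i))" for h
    by (simp add: inner_eq_sum_blocks)
  moreover have "(total_cost f has_derivative (\<lambda>h. \<Sum>i\<in>UNIV. block h i \<bullet> grad (f i) (block x i))) (at x)"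
    unfolding total_cost_def [abs_def]
  proof (rule has_derivative_sum)
    fix i
    have "(f i has_derivative (\<lambda>h. h \<bullet> grad (f i) (block x i))) (at (block x i))"
      using GDERIV_grad [OF assms] by (simp add: gderiv_def)
    with bounded_linear_imp_has_derivative [OF bounded_linear_block]
    show "((\<lambda>x. f i (block x i)) has_derivative (\<lambda>h. block h i \<bullet> grad (f i) (block x i))) (at x)"
      by (rule has_derivative_compose)
  qed
  ultimately show ?thesis
    by (simp add: gderiv_def)
qed

lemma block_grad_total_cost:
  assumes "\<And>i. f i differentiable_on UNIV"
  shows "block (grad (total_cost f) x) i = grad (f i) (block x i)"
  by (simp add: grad_eqI [OF GDERIV_total_cost [OF assms]] block_def vec_eq_iff)

lemma GDERIV_grad_total_cost:
  assumes "\<And>i. f i differentiable_on UNIV"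
  shows "GDERIV (total_cost f) x :> grad (total_cost f) x"
  unfolding grad_eqI [OF GDERIV_total_cost [OF assms]] by (rule GDERIV_total_cost [OF assms])

lemma convex_on_total_cost:
  fixes f :: "'n::finite \<Rightarrow> real^('d::finite) \<Rightarrow> real"
  assumes "\<And>i. convex_on UNIV (f i)"
  shows "convex_on UNIV (total_cost f)"
proof (rule convex_onI)
  fix t :: real and x y :: "real^('n \<times> 'd)"
  assume t: "0 < t" "t < 1"
  have "total_cost f ((1 - t) *\<^sub>R x + t *\<^sub>R y)
      \<le> (\<Sum>i\<in>UNIV. (1 - t) * f i (block x i) + t * f i (block y i))"
    unfolding total_cost_def block_add block_scaleR
    using t by (intro sum_mono convex_onD [OF assms]) auto
  then show "total_cost f ((1 - t) *\<^sub>R x + t *\<^sub>R y) \<le> (1 - t) * total_cost f x + t * total_cost f y"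
    by (simp add: total_cost_def sum.distrib sum_distrib_left)
qed simp

theorem lemma2:
  fixes E :: "'n::finite set set"
    and W :: "real^'n^'n"
    and f :: "'n \<Rightarrow> real^'d \<Rightarrow> real"
    and Ls \<mu> :: "'n \<Rightarrow> real"
    and \<alpha> :: real
  defines "fsum \<equiv> \<lambda>x. \<Sum>i\<in>UNIV. f i x"
  defines "fstar \<equiv> INF x. fsum x"
  defines "L \<equiv> Max (range Ls)"
  defines "\<beta> \<equiv> max \<bar>nth_eigenvalue 2 W\<bar> \<bar>nth_eigenvalue CARD('n) W\<bar>"
  defines "C \<equiv> 2 * L * (fstar - (\<Sum>i\<in>UNIV. INF x. f i x))"
  assumes "CARD('n) \<ge> 2"
    and "undirected_graph E" and "graph_connected E"
    and "averaging_matrix E W"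
    and "positive_definite W"
    and "\<alpha> > 0"
    and "\<And>i. proper_function (\<lambda>x. ereal (f i x))"
    and "\<And>i. closed (epigraph UNIV (f i))"
    and "\<And>i. convex_on UNIV (f i)"
    and "\<And>i. bdd_below (range (f i))"
    and "\<And>i. Ls i > 0"
    and "\<And>i. L_smooth (Ls i) (f i)"
    and "{x. is_arg_min fsum (\<lambda>_. True) x} \<noteq> {}"
    and "bounded {x. is_arg_min fsum (\<lambda>_. True) x}"
  shows "dgd_atc_fixed_points W \<alpha> f \<noteq> {} \<and>
    (\<forall>x \<in> dgd_atc_fixed_points W \<alpha> f.
       (\<forall>i. norm (block x i - block_mean x) \<le> \<alpha> * sqrt C / (1 - \<beta>)) \<and>
       fsum (block_mean x) - fstar
         \<le> (\<alpha> / (1 - \<beta>) + L * \<alpha>\<^sup>2 / (2 * (1 - \<beta>)\<^sup>2)) * C) \<and>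
    ((\<forall>i. \<mu> i > 0 \<and> strongly_convex (\<mu> i) (f i)) \<longrightarrow>
       (\<exists>!x. x \<in> dgd_atc_fixed_points W \<alpha> f))"
proof -
  note card = assms(6) and conn = assms(8) and avg = assms(9) and pd = assms(10) and \<alpha> = assms(11)
    and convf = assms(14) and bdd = assms(15) and Lpos = assms(16) and smooth = assms(17)
    and argmin_ne = assms(18) and argmin_bdd = assms(19)
  let ?F = "total_cost f"
  let ?G = "grad ?F"
  interpret averaging_operator "mix W :: real^('n \<times> 'd) \<Rightarrow> real^('n \<times> 'd)"
    by (rule averaging_operator_mix [OF avg pd])
  have diff: "f i differentiable_on UNIV" for i
    using smooth by (simp add: L_smooth_def)
  note block_G = block_grad_total_cost [of f, OF diff]
  note GF = GDERIV_grad_total_cost [of f, OF diff]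
  have convF: "convex_on UNIV ?F"
    using convf by (rule convex_on_total_cost)
  have fixed_iff: "x \<in> dgd_atc_fixed_points W \<alpha> f \<longleftrightarrow> x = mix W (x - \<alpha> *\<^sub>R ?G x)" for x
    by (simp add: dgd_atc_fixed_points_def dgd_atc_step_def)
  have gap: "0 \<le> \<beta>" "\<beta> < 1" and contract: "\<And>v. (\<Sum>i\<in>UNIV. v $ i) = 0 \<Longrightarrow> norm (W *v v) \<le> \<beta> * norm v"
    using averaging_matrix_spectral_gap [OF card conn avg pd] unfolding \<beta>_def by blast+

  let ?m = "\<Sum>i\<in>UNIV. INF x. f i x"
  have lower: "(INF x. f i x) \<le> f i v" for i v
    using bdd by (simp add: cINF_lower)
  have argmin_iff: "is_arg_min fsum (\<lambda>_. True) x \<longleftrightarrow> (\<forall>v. fsum x \<le> fsum v)" for x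
    by (simp add: is_arg_min_linorder)
  obtain z where z: "\<And>v. fsum z \<le> fsum v"
    using argmin_ne unfolding argmin_iff by blast
  have fstar: "fstar = fsum z"
    unfolding fstar_def by (rule cInf_eq_minimum) (auto intro: z)
  have F_consensus: "?F (consensus v) = fsum v" for v
    by (simp add: total_cost_def fsum_def)
  have F_lower: "?m \<le> ?F x" for x
    unfolding total_cost_def by (intro sum_mono lower)
  have L: "Ls i \<le> L" "L > 0" for i
  proof -
    show "Ls i \<le> L" for i
      by (simp add: L_def)
    from this [of undefined] show "L > 0"
      using Lpos [of undefined] by linarith
  qed

  \<comment> \<open>On consensus vectors the stacked cost is \<open>fsum\<close>, so the boundedness of its set of minimisers is
    exactly what the existence criterion asks for.\<close>
  have "bounded {v. mix W v = v \<and> ?F v \<le> ?F (consensus z)}"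
  proof (rule bounded_subset)
    show "bounded (consensus ` {x. is_arg_min fsum (\<lambda>_. True) x} :: (real^('n \<times> 'd)) set)"
      using argmin_bdd bounded_linear_consensus by (rule bounded_linear_image)
    show "{v. mix W v = v \<and> ?F v \<le> ?F (consensus z)} \<subseteq> consensus ` {x. is_arg_min fsum (\<lambda>_. True) x}"
    proof
      fix v assume "v \<in> {v. mix W v = v \<and> ?F v \<le> ?F (consensus z)}"
      then have v: "v = consensus (block v undefined)" and le: "?F v \<le> fsum z"
        using mix_fixed_imp_consensus [OF avg conn] by (auto simp: F_consensus)
      then have "fsum (block v undefined) \<le> fsum z"
        by (metis F_consensus)
      then have "is_arg_min fsum (\<lambda>_. True) (block v undefined)"
        unfolding argmin_iff using z by (meson order_trans)
      with v show "v \<in> consensus ` {x. is_arg_min fsum (\<lambda>_. True) x}"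
        by blast
    qed
  qed
  moreover have "bdd_below (range ?F)"
    using F_lower by (auto simp: bdd_below_def)
  ultimately have ex: "\<exists>x. x = mix W (x - \<alpha> *\<^sub>R ?G x)"
    using fixed_point_exists [OF convF GF _ \<alpha> mix_consensus [OF avg]] by blast

  have estimates: "(\<forall>i. norm (block x i - block_mean x) \<le> \<alpha> * sqrt C / (1 - \<beta>)) \<and>
       fsum (block_mean x) - fstar
         \<le> (\<alpha> / (1 - \<beta>) + L * \<alpha>\<^sup>2 / (2 * (1 - \<beta>)\<^sup>2)) * C"
    if fp: "x = mix W (x - \<alpha> *\<^sub>R ?G x)" for x
  proof -
    define e where "e = x - consensus (block_mean x)"
    have Fx: "?F x \<le> fstar"
      using fixed_point_le_consensus [OF convF GF \<alpha> fp mix_consensus [OF avg, of z]]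
      by (simp add: F_consensus fstar)
    have "(norm (?G x))\<^sup>2 \<le> C"
    proof -
      have "(norm (?G x))\<^sup>2 = (\<Sum>i\<in>UNIV. (norm (grad (f i) (block x i)))\<^sup>2)"
        by (simp add: norm_sq_eq_sum_blocks block_G)
      also have "\<dots> \<le> (\<Sum>i\<in>UNIV. 2 * L * (f i (block x i) - (INF v. f i v)))"
      proof (rule sum_mono)
        fix i
        have "(norm (grad (f i) (block x i)))\<^sup>2 \<le> 2 * Ls i * (f i (block x i) - (INF v. f i v))"
          by (rule L_smooth_grad_norm_bound [OF smooth Lpos bdd])
        also have "\<dots> \<le> 2 * L * (f i (block x i) - (INF v. f i v))"
          using L lower [of i "block x i"] by (intro mult_right_mono) auto
        finally show "(norm (grad (f i) (block x i)))\<^sup>2 \<le> 2 * L * (f i (block x i) - (INF v. f i v))" .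
      qed
      also have "\<dots> = 2 * L * (?F x - ?m)"
        by (simp add: total_cost_def sum_subtractf flip: sum_distrib_left)
      also have "\<dots> \<le> C"
        using Fx L by (simp add: C_def)
      finally show ?thesis .
    qed
    then have normG: "norm (?G x) \<le> sqrt C"
      by (rule real_le_rsqrt)
    then have C: "C \<ge> 0"
      using order_trans [OF norm_ge_zero normG] by simp
    \<comment> \<open>Since mixing preserves the mean, the gradients at a fixed point sum to zero. So the deviation
      \<open>e\<close> and the gradient both lie in the subspace on which \<open>W \<otimes> I\<close> contracts by \<open>\<beta>\<close>.\<close>
    have "(\<Sum>i\<in>UNIV. block x i) = (\<Sum>i\<in>UNIV. block (x - \<alpha> *\<^sub>R ?G x) i)"
      using sum_block_mix [OF avg, of "x - \<alpha> *\<^sub>R ?G x"] unfolding fp [symmetric] .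
    also have "\<dots> = (\<Sum>i\<in>UNIV. block x i) - \<alpha> *\<^sub>R (\<Sum>i\<in>UNIV. block (?G x) i)"
      by (simp only: block_diff block_scaleR sum_subtractf scaleR_sum_right)
    finally have sumG: "(\<Sum>i\<in>UNIV. block (?G x) i) = 0"
      using \<alpha> by simp
    have sume: "(\<Sum>i\<in>UNIV. block e i) = 0"
      by (simp add: e_def block_diff sum_subtractf block_mean_def sum_constant_scaleR del: sum_constant)
    have "mix W x - \<alpha> *\<^sub>R mix W (?G x) = x"
      using fp [symmetric] by (simp only: linear_diff [OF lin] linear_scale [OF lin])
    then have "mix W e - \<alpha> *\<^sub>R mix W (?G x) = e"
      by (simp add: e_def linear_diff [OF lin] mix_consensus [OF avg] algebra_simps)
    then have "norm e \<le> norm (mix W e) + \<alpha> * norm (mix W (?G x))"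
      using norm_triangle_ineq4 [of "mix W e" "\<alpha> *\<^sub>R mix W (?G x)"] \<alpha> by simp
    also have "\<dots> \<le> \<beta> * norm e + \<alpha> * (\<beta> * norm (?G x))"
      using norm_mix_le [OF contract gap(1) sume] norm_mix_le [OF contract gap(1) sumG] \<alpha>
      by (intro add_mono mult_left_mono) auto
    also have "\<dots> \<le> \<beta> * norm e + \<alpha> * (1 * sqrt C)"
      using \<alpha> gap normG by (intro add_mono mult_left_mono mult_mono) auto
    finally have "(1 - \<beta>) * norm e \<le> \<alpha> * sqrt C"
      by (simp add: algebra_simps)
    then have norme: "norm e \<le> \<alpha> * sqrt C / (1 - \<beta>)"
      using gap by (simp add: pos_le_divide_eq mult.commute)
    have block_e: "block e i = block x i - block_mean x" for i
      by (simp add: e_def block_diff)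
    have "fsum (block_mean x)
        \<le> (\<Sum>i\<in>UNIV. f i (block x i) + block (?G x) i \<bullet> (- block e i) + L / 2 * (norm (block e i))\<^sup>2)"
      unfolding fsum_def
    proof (rule sum_mono)
      fix i
      have "f i (block_mean x) \<le> f i (block x i) + grad (f i) (block x i) \<bullet> (block_mean x - block x i)
          + Ls i / 2 * (norm (block_mean x - block x i))\<^sup>2"
        by (rule L_smooth_upper_bound [OF smooth])
      also have "\<dots> \<le> f i (block x i) + grad (f i) (block x i) \<bullet> (block_mean x - block x i)
          + L / 2 * (norm (block_mean x - block x i))\<^sup>2"
        using L(1) by (intro add_mono mult_right_mono) auto
      finally show "f i (block_mean x) \<le> f i (block x i) + block (?G x) i \<bullet> (- block e i) + L / 2 * (norm (block e i))\<^sup>2"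
        by (simp add: block_G block_e norm_minus_commute)
    qed
    also have "\<dots> = ?F x - ?G x \<bullet> e + L / 2 * (norm e)\<^sup>2"
      by (simp add: sum.distrib sum_negf total_cost_def inner_eq_sum_blocks [of "?G x"]
          norm_sq_eq_sum_blocks [of e] sum_distrib_left sum_subtractf)
    also have "\<dots> \<le> fstar + sqrt C * (\<alpha> * sqrt C / (1 - \<beta>)) + L / 2 * (\<alpha> * sqrt C / (1 - \<beta>))\<^sup>2"
    proof -
      have "- (?G x \<bullet> e) \<le> norm (?G x) * norm e"
        using norm_cauchy_schwarz [of "- ?G x" e] by simp
      also have "\<dots> \<le> sqrt C * (\<alpha> * sqrt C / (1 - \<beta>))"
        using normG norme C by (intro mult_mono) auto
      finally have "- (?G x \<bullet> e) \<le> sqrt C * (\<alpha> * sqrt C / (1 - \<beta>))" .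
      moreover have "L / 2 * (norm e)\<^sup>2 \<le> L / 2 * (\<alpha> * sqrt C / (1 - \<beta>))\<^sup>2"
        using L norme by (intro mult_left_mono power_mono) auto
      ultimately show ?thesis
        using Fx by linarith
    qed
    also have "\<dots> = fstar + (\<alpha> / (1 - \<beta>) + L * \<alpha>\<^sup>2 / (2 * (1 - \<beta>)\<^sup>2)) * C"
    proof -
      have "sqrt C * (\<alpha> * sqrt C / (1 - \<beta>)) = \<alpha> / (1 - \<beta>) * (sqrt C)\<^sup>2"
        by (simp add: power2_eq_square)
      moreover have "L / 2 * (\<alpha> * sqrt C / (1 - \<beta>))\<^sup>2 = L * \<alpha>\<^sup>2 / (2 * (1 - \<beta>)\<^sup>2) * (sqrt C)\<^sup>2"
        by (simp add: power_mult_distrib power_divide)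
      ultimately show ?thesis
        using C by (simp add: algebra_simps)
    qed
    finally have "fsum (block_mean x) - fstar \<le> (\<alpha> / (1 - \<beta>) + L * \<alpha>\<^sup>2 / (2 * (1 - \<beta>)\<^sup>2)) * C"
      by simp
    moreover have "norm (block x i - block_mean x) \<le> \<alpha> * sqrt C / (1 - \<beta>)" for i
      using norm_block_le [of e i] norme by (simp add: block_e)
    ultimately show ?thesis
      by blast
  qed

  have unique: "x = y"
    if sc: "\<forall>i. \<mu> i > 0 \<and> strongly_convex (\<mu> i) (f i)"
      and fp: "x = mix W (x - \<alpha> *\<^sub>R ?G x)" "y = mix W (y - \<alpha> *\<^sub>R ?G y)" for x y
  proof -
    have "(\<Sum>i\<in>UNIV. \<mu> i * (norm (block x i - block y i))\<^sup>2) \<le> (?G x - ?G y) \<bullet> (x - y)"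
      unfolding inner_eq_sum_blocks block_diff block_G
      using sc by (intro sum_mono) (simp add: strongly_convex_def)
    also have "\<dots> \<le> 0"
      by (rule fixed_points_grad_antimono [OF \<alpha> fp])
    finally have "(\<Sum>i\<in>UNIV. \<mu> i * (norm (block x i - block y i))\<^sup>2) = 0"
      using sc by (intro antisym sum_nonneg mult_nonneg_nonneg) (auto intro: less_imp_le)
    then have "\<mu> i * (norm (block x i - block y i))\<^sup>2 = 0" for i
      using sc by (subst (asm) sum_nonneg_eq_0_iff) (auto intro!: mult_nonneg_nonneg intro: less_imp_le)
    moreover have "\<mu> i \<noteq> 0" for i
      using sc by (metis less_irrefl)
    ultimately show ?thesis
      by (intro stacked_eqI) simp
  qed

  show ?thesis
    using ex estimates unique fixed_iff by blast
qed

end
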